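(* (i) The sequent calculus $\mathbf{GSix}$ is sound and complete with respect to the matrix $\mathcal{M}_6$; that is, a sequent $\Gamma\Rightarrow\Delta$ is provable in $\mathbf{GSix}$ if and only if it is valid in $\mathcal{M}_6$. (ii) The cut rule $$\frac{\Gamma\Rightarrow\Delta,\alpha\qquad \alpha,\Gamma\Rightarrow\Delta}{\Gamma\Rightarrow\Delta}$$ is admissible in $\mathbf{GSix}$; that is, whenever both premises are provable in $\mathbf{GSix}$, so is the conclusion.
   Context: Formulas are built from a denumerable set of propositional variables with the binary connectives $\wedge,\vee$ and the unary connectives $\neg,\nabla$. A sequent $\Gamma\Rightarrow\Delta$ is a pair of finite (possibly empty) sets of formulas; commas denote union. The matrix $\mathcal{M}_6$: the set of truth values is $\mathcal{T}_6=\{\mathbf 0,\frac13,\mathbf n,\mathbf b,\frac23,\mathbf 1\}$, ordered as the lattice $\mathbf 0<\frac13<\mathbf n<\frac23<\mathbf 1$ and $\frac13<\mathbf b<\frac23$, with $\mathbf n,\mathbf b$ incomparable. The designated values are $\mathcal{D}=\{\mathbf b,\frac23,\mathbf 1\}$. The connectives are interpreted by $x\hat\wedge y=\inf\{x,y\}$, $x\hat\vee y=\sup\{x,y\}$; $\hat\neg\mathbf 0=\mathbf 1$, $\hat\neg\frac13=\frac23$, $\hat\neg\mathbf n=\mathbf n$, $\hat\neg\mathbf b=\mathbf b$, $\hat\neg\frac23=\frac13$, $\hat\neg\mathbf 1=\mathbf 0$; $\hat\nabla\mathbf 0=\mathbf 0$ and $\hat\nabla x=\mathbf 1$ for $x\neq\mathbf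 0$. A valuation is a map $v$ from formulas to $\mathcal{T}_6$ commuting with the connectives. A sequent $\Gamma\Rightarrow\Delta$ is satisfied by $v$ if $v(\gamma)\notin\mathcal{D}$ for some $\gamma\in\Gamma$ or $v(\delta)\in\mathcal{D}$ for some $\delta\in\Delta$; it is valid in $\mathcal{M}_6$ if satisfied by every valuation. The calculus $\mathbf{GSix}$ (which does not contain the cut rule) has the axioms $\alpha\Rightarrow\alpha$ and the following rules, written "premises / conclusion": Weakening: $\Gamma\Rightarrow\Delta\ /\ \Gamma,\alpha\Rightarrow\Delta$; $\quad\Gamma\Rightarrow\Delta\ /\ \Gamma\Rightarrow\Delta,\alpha$. $(\vee\Rightarrow)$: $\alpha,\Gamma\Rightarrow\Delta$ and $\beta,\Gamma\Rightarrow\Delta$ / $\alpha\vee\beta,\Gamma\Rightarrow\Delta$. $(\Rightarrow\vee)$: $\Gamma\Rightarrow\alpha,\beta,\Delta$ / $\Gamma\Rightarrow\alpha\vee\beta,\Delta$. $(\neg\vee\Rightarrow)$: $\neg\alpha,\neg\beta,\Gamma\Rightarrow\Delta$ / $\neg(\alpha\vee\beta),\Gamma\Rightarrow\Delta$. $(\Rightarrow\neg\vee)$: $\Gamma\Rightarrow\neg\alpha,\Delta$ and $\Gamma\Rightarrow\neg\beta,\Delta$ / $\Gamma\Rightarrow\neg(\alpha\vee\beta),\Delta$. $(\nabla\vee\Rightarrow)$: $\nabla\alpha,\Gamma\Rightarrow\Delta$ and $\nabla\beta,\Gamma\Rightarrow\Delta$ / $\nabla(\alpha\vee\beta),\Gamma\Rightarrow\Delta$.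 $(\Rightarrow\nabla\vee)$: $\Gamma\Rightarrow\nabla\alpha,\nabla\beta,\Delta$ / $\Gamma\Rightarrow\nabla(\alpha\vee\beta),\Delta$. $(\nabla\neg\vee\Rightarrow)$: $\nabla\neg\alpha,\nabla\neg\beta,\Gamma\Rightarrow\Delta$ / $\nabla\neg(\alpha\vee\beta),\Gamma\Rightarrow\Delta$. $(\Rightarrow\nabla\neg\vee)$: $\Gamma\Rightarrow\nabla\neg\alpha,\Delta$ and $\Gamma\Rightarrow\nabla\neg\beta,\Delta$ / $\Gamma\Rightarrow\nabla\neg(\alpha\vee\beta),\Delta$. $(\wedge\Rightarrow)$: $\alpha,\beta,\Gamma\Rightarrow\Delta$ / $\alpha\wedge\beta,\Gamma\Rightarrow\Delta$. $(\Rightarrow\wedge)$: $\Gamma\Rightarrow\alpha,\Delta$ and $\Gamma\Rightarrow\beta,\Delta$ / $\Gamma\Rightarrow\alpha\wedge\beta,\Delta$. $(\neg\wedge\Rightarrow)$: $\neg\alpha,\Gamma\Rightarrow\Delta$ and $\neg\beta,\Gamma\Rightarrow\Delta$ / $\neg(\alpha\wedge\beta),\Gamma\Rightarrow\Delta$. $(\Rightarrow\neg\wedge)$: $\Gamma\Rightarrow\neg\alpha,\neg\beta,\Delta$ / $\Gamma\Rightarrow\neg(\alpha\wedge\beta),\Delta$. $(\nabla\wedge\Rightarrow)$: $\nabla\alpha,\nabla\beta,\Gamma\Rightarrow\Delta$ / $\nabla(\alpha\wedge\beta),\Gamma\Rightarrow\Delta$. $(\Rightarrow\nabla\wedge)$: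 $\Gamma\Rightarrow\nabla\alpha,\Delta$ and $\Gamma\Rightarrow\nabla\beta,\Delta$ / $\Gamma\Rightarrow\nabla(\alpha\wedge\beta),\Delta$. $(\nabla\neg\wedge\Rightarrow)$: $\nabla\neg\alpha,\Gamma\Rightarrow\Delta$ and $\nabla\neg\beta,\Gamma\Rightarrow\Delta$ / $\nabla\neg(\alpha\wedge\beta),\Gamma\Rightarrow\Delta$. $(\Rightarrow\nabla\neg\wedge)$: $\Gamma\Rightarrow\nabla\neg\alpha,\nabla\neg\beta,\Delta$ / $\Gamma\Rightarrow\nabla\neg(\alpha\wedge\beta),\Delta$. $(\neg\neg\Rightarrow)$: $\alpha,\Gamma\Rightarrow\Delta$ / $\neg\neg\alpha,\Gamma\Rightarrow\Delta$. $(\Rightarrow\neg\neg)$: $\Gamma\Rightarrow\Delta,\alpha$ / $\Gamma\Rightarrow\Delta,\neg\neg\alpha$. $(\nabla\neg\neg\Rightarrow)$: $\nabla\alpha,\Gamma\Rightarrow\Delta$ / $\nabla\neg\neg\alpha,\Gamma\Rightarrow\Delta$. $(\Rightarrow\nabla\neg\neg)$: $\Gamma\Rightarrow\Delta,\nabla\alpha$ / $\Gamma\Rightarrow\Delta,\nabla\neg\neg\alpha$. $(\Rightarrow\nabla)$: $\Gamma,\neg\alpha\Rightarrow\Delta,\alpha$ / $\Gamma\Rightarrow\Delta,\nabla\alpha$. $(\nabla\Rightarrow)$: $\nabla\alpha,\Gamma\Rightarrow\Delta$ / $\nabla\nabla\alpha,\Gamma\Rightarrow\Delta$. $(\neg\nabla\Rightarrow)$: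 $\Gamma\Rightarrow\Delta,\nabla\alpha$ / $\neg\nabla\alpha,\Gamma\Rightarrow\Delta$. $(\Rightarrow\neg\nabla)$: $\nabla\alpha,\Gamma\Rightarrow\Delta$ / $\Gamma\Rightarrow\neg\nabla\alpha,\Delta$. $(\nabla\neg\nabla\Rightarrow)$: $\Gamma\Rightarrow\Delta,\nabla\alpha$ / $\Gamma,\nabla\neg\nabla\alpha\Rightarrow\Delta$. *)

theory Defs
  imports "HOL-Library.FSet"
begin

datatype fm =
    Var nat
  | Conj fm fm  (infixr "\<^bold>\<and>" 75)
  | Disj fm fm  (infixr "\<^bold>\<or>" 70)
  | Neg fm  ("\<^bold>\<not> _" [80] 80)
  | Nabla fm  ("\<nabla> _" [80] 80)

datatype sequent = Sequent "fm fset" "fm fset"  (infix "\<Rrightarrow>" 50)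

datatype tv = Zero | Third | Nn | Bb | TwoThirds | One

instantiation tv :: lattice
begin

definition less_eq_tv :: "tv \<Rightarrow> tv \<Rightarrow> bool" where
  "x \<le> y \<longleftrightarrow> x = y \<or> x = Zero \<or> y = One \<or> (x = Third \<and> y \<noteq> Zero) \<or> (y = TwoThirds \<and> x \<noteq> One)"

definition less_tv :: "tv \<Rightarrow> tv \<Rightarrow> bool" where
  "(x :: tv) < y \<longleftrightarrow> x \<le> y \<and> x \<noteq> y"

(* The only incomparable pair is Nn, Bb; its meet is Third and its join is TwoThirds. *)
definition inf_tv :: "tv \<Rightarrow> tv \<Rightarrow> tv" where
  "inf (x :: tv) y = (if x \<le> y then x else if y \<le> x then y else Third)"

definition sup_tv :: "tv \<Rightarrow> tv \<Rightarrow> tv" where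
  "sup (x :: tv) y = (if x \<le> y then y else if y \<le> x then x else TwoThirds)"

instance
proof
  fix x y z :: tv
  show "x < y \<longleftrightarrow> x \<le> y \<and> \<not> y \<le> x"
    by (cases x; cases y) (simp_all add: less_tv_def less_eq_tv_def)
  show "x \<le> x"
    by (simp add: less_eq_tv_def)
  show "x \<le> y \<Longrightarrow> y \<le> z \<Longrightarrow> x \<le> z"
    by (cases x; cases y; cases z) (simp_all add: less_eq_tv_def)
  show "x \<le> y \<Longrightarrow> y \<le> x \<Longrightarrow> x = y"
    by (cases x; cases y) (simp_all add: less_eq_tv_def)
  show "inf x y \<le> x" "inf x y \<le> y" "x \<le> sup x y" "y \<le> sup x y"
    by (cases x; cases y; simp add: less_eq_tv_def inf_tv_def sup_tv_def)+
  show "x \<le> y \<Longrightarrow> x \<le> z \<Longrightarrow> x \<le> inf y z"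
    by (cases x; cases y; cases z) (simp_all add: less_eq_tv_def inf_tv_def)
  show "y \<le> x \<Longrightarrow> z \<le> x \<Longrightarrow> sup y z \<le> x"
    by (cases x; cases y; cases z) (simp_all add: less_eq_tv_def sup_tv_def)
qed

end

definition designated :: "tv set" where
  "designated = {Bb, TwoThirds, One}"

fun neg_tv :: "tv \<Rightarrow> tv" where
  "neg_tv Zero = One"
| "neg_tv Third = TwoThirds"
| "neg_tv Nn = Nn"
| "neg_tv Bb = Bb"
| "neg_tv TwoThirds = Third"
| "neg_tv One = Zero"

definition nabla_tv :: "tv \<Rightarrow> tv" where
  "nabla_tv x = (if x = Zero then Zero else One)"

definition valuation :: "(fm \<Rightarrow> tv) \<Rightarrow> bool" where
  "valuation v \<longleftrightarrow>
     (\<forall>\<alpha> \<beta>. v (\<alpha> \<^bold>\<and> \<beta>) = inf (v \<alpha>) (v \<beta>)) \<and>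
     (\<forall>\<alpha> \<beta>. v (\<alpha> \<^bold>\<or> \<beta>) = sup (v \<alpha>) (v \<beta>)) \<and>
     (\<forall>\<alpha>. v (\<^bold>\<not> \<alpha>) = neg_tv (v \<alpha>)) \<and>
     (\<forall>\<alpha>. v (\<nabla> \<alpha>) = nabla_tv (v \<alpha>))"

fun satisfies :: "(fm \<Rightarrow> tv) \<Rightarrow> sequent \<Rightarrow> bool" where
  "satisfies v (\<Gamma> \<Rrightarrow> \<Delta>) \<longleftrightarrow>
     (\<exists>\<gamma>. \<gamma> |\<in>| \<Gamma> \<and> v \<gamma> \<notin> designated) \<or> (\<exists>\<delta>. \<delta> |\<in>| \<Delta> \<and> v \<delta> \<in> designated)"

definition valid :: "sequent \<Rightarrow> bool" where
  "valid S \<longleftrightarrow> (\<forall>v. valuation v \<longrightarrow> satisfies v S)"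

(* Contexts are sets, so in each rule the principal and side formulas may already belong
   to the context; contraction and exchange are therefore built in. *)
inductive GSix :: "sequent \<Rightarrow> bool" where
  Ax: "GSix ({|\<alpha>|} \<Rrightarrow> {|\<alpha>|})"
| WeakL: "GSix (\<Gamma> \<Rrightarrow> \<Delta>) \<Longrightarrow> GSix (finsert \<alpha> \<Gamma> \<Rrightarrow> \<Delta>)"
| WeakR: "GSix (\<Gamma> \<Rrightarrow> \<Delta>) \<Longrightarrow> GSix (\<Gamma> \<Rrightarrow> finsert \<alpha> \<Delta>)"

| DisjL: "GSix (finsert \<alpha> \<Gamma> \<Rrightarrow> \<Delta>) \<Longrightarrow> GSix (finsert \<beta> \<Gamma> \<Rrightarrow> \<Delta>)
    \<Longrightarrow> GSix (finsert (\<alpha> \<^bold>\<or> \<beta>) \<Gamma> \<Rrightarrow> \<Delta>)"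
| DisjR: "GSix (\<Gamma> \<Rrightarrow> finsert \<alpha> (finsert \<beta> \<Delta>))
    \<Longrightarrow> GSix (\<Gamma> \<Rrightarrow> finsert (\<alpha> \<^bold>\<or> \<beta>) \<Delta>)"
| NegDisjL: "GSix (finsert (\<^bold>\<not> \<alpha>) (finsert (\<^bold>\<not> \<beta>) \<Gamma>) \<Rrightarrow> \<Delta>)
    \<Longrightarrow> GSix (finsert (\<^bold>\<not> (\<alpha> \<^bold>\<or> \<beta>)) \<Gamma> \<Rrightarrow> \<Delta>)"
| NegDisjR: "GSix (\<Gamma> \<Rrightarrow> finsert (\<^bold>\<not> \<alpha>) \<Delta>) \<Longrightarrow> GSix (\<Gamma> \<Rrightarrow> finsert (\<^bold>\<not> \<beta>) \<Delta>)
    \<Longrightarrow> GSix (\<Gamma> \<Rrightarrow> finsert (\<^bold>\<not> (\<alpha> \<^bold>\<or> \<beta>)) \<Delta>)"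
| NablaDisjL: "GSix (finsert (\<nabla> \<alpha>) \<Gamma> \<Rrightarrow> \<Delta>) \<Longrightarrow> GSix (finsert (\<nabla> \<beta>) \<Gamma> \<Rrightarrow> \<Delta>)
    \<Longrightarrow> GSix (finsert (\<nabla> (\<alpha> \<^bold>\<or> \<beta>)) \<Gamma> \<Rrightarrow> \<Delta>)"
| NablaDisjR: "GSix (\<Gamma> \<Rrightarrow> finsert (\<nabla> \<alpha>) (finsert (\<nabla> \<beta>) \<Delta>))
    \<Longrightarrow> GSix (\<Gamma> \<Rrightarrow> finsert (\<nabla> (\<alpha> \<^bold>\<or> \<beta>)) \<Delta>)"
| NablaNegDisjL: "GSix (finsert (\<nabla> (\<^bold>\<not> \<alpha>)) (finsert (\<nabla> (\<^bold>\<not> \<beta>)) \<Gamma>) \<Rrightarrow> \<Delta>)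
    \<Longrightarrow> GSix (finsert (\<nabla> (\<^bold>\<not> (\<alpha> \<^bold>\<or> \<beta>))) \<Gamma> \<Rrightarrow> \<Delta>)"
| NablaNegDisjR: "GSix (\<Gamma> \<Rrightarrow> finsert (\<nabla> (\<^bold>\<not> \<alpha>)) \<Delta>) \<Longrightarrow> GSix (\<Gamma> \<Rrightarrow> finsert (\<nabla> (\<^bold>\<not> \<beta>)) \<Delta>)
    \<Longrightarrow> GSix (\<Gamma> \<Rrightarrow> finsert (\<nabla> (\<^bold>\<not> (\<alpha> \<^bold>\<or> \<beta>))) \<Delta>)"

| ConjL: "GSix (finsert \<alpha> (finsert \<beta> \<Gamma>) \<Rrightarrow> \<Delta>)
    \<Longrightarrow> GSix (finsert (\<alpha> \<^bold>\<and> \<beta>) \<Gamma> \<Rrightarrow> \<Delta>)"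
| ConjR: "GSix (\<Gamma> \<Rrightarrow> finsert \<alpha> \<Delta>) \<Longrightarrow> GSix (\<Gamma> \<Rrightarrow> finsert \<beta> \<Delta>)
    \<Longrightarrow> GSix (\<Gamma> \<Rrightarrow> finsert (\<alpha> \<^bold>\<and> \<beta>) \<Delta>)"
| NegConjL: "GSix (finsert (\<^bold>\<not> \<alpha>) \<Gamma> \<Rrightarrow> \<Delta>) \<Longrightarrow> GSix (finsert (\<^bold>\<not> \<beta>) \<Gamma> \<Rrightarrow> \<Delta>)
    \<Longrightarrow> GSix (finsert (\<^bold>\<not> (\<alpha> \<^bold>\<and> \<beta>)) \<Gamma> \<Rrightarrow> \<Delta>)"
| NegConjR: "GSix (\<Gamma> \<Rrightarrow> finsert (\<^bold>\<not> \<alpha>) (finsert (\<^bold>\<not> \<beta>) \<Delta>))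
    \<Longrightarrow> GSix (\<Gamma> \<Rrightarrow> finsert (\<^bold>\<not> (\<alpha> \<^bold>\<and> \<beta>)) \<Delta>)"
| NablaConjL: "GSix (finsert (\<nabla> \<alpha>) (finsert (\<nabla> \<beta>) \<Gamma>) \<Rrightarrow> \<Delta>)
    \<Longrightarrow> GSix (finsert (\<nabla> (\<alpha> \<^bold>\<and> \<beta>)) \<Gamma> \<Rrightarrow> \<Delta>)"
| NablaConjR: "GSix (\<Gamma> \<Rrightarrow> finsert (\<nabla> \<alpha>) \<Delta>) \<Longrightarrow> GSix (\<Gamma> \<Rrightarrow> finsert (\<nabla> \<beta>) \<Delta>)
    \<Longrightarrow> GSix (\<Gamma> \<Rrightarrow> finsert (\<nabla> (\<alpha> \<^bold>\<and> \<beta>)) \<Delta>)"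
| NablaNegConjL: "GSix (finsert (\<nabla> (\<^bold>\<not> \<alpha>)) \<Gamma> \<Rrightarrow> \<Delta>) \<Longrightarrow> GSix (finsert (\<nabla> (\<^bold>\<not> \<beta>)) \<Gamma> \<Rrightarrow> \<Delta>)
    \<Longrightarrow> GSix (finsert (\<nabla> (\<^bold>\<not> (\<alpha> \<^bold>\<and> \<beta>))) \<Gamma> \<Rrightarrow> \<Delta>)"
| NablaNegConjR: "GSix (\<Gamma> \<Rrightarrow> finsert (\<nabla> (\<^bold>\<not> \<alpha>)) (finsert (\<nabla> (\<^bold>\<not> \<beta>)) \<Delta>))
    \<Longrightarrow> GSix (\<Gamma> \<Rrightarrow> finsert (\<nabla> (\<^bold>\<not> (\<alpha> \<^bold>\<and> \<beta>))) \<Delta>)"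

| NegNegL: "GSix (finsert \<alpha> \<Gamma> \<Rrightarrow> \<Delta>) \<Longrightarrow> GSix (finsert (\<^bold>\<not> (\<^bold>\<not> \<alpha>)) \<Gamma> \<Rrightarrow> \<Delta>)"
| NegNegR: "GSix (\<Gamma> \<Rrightarrow> finsert \<alpha> \<Delta>) \<Longrightarrow> GSix (\<Gamma> \<Rrightarrow> finsert (\<^bold>\<not> (\<^bold>\<not> \<alpha>)) \<Delta>)"
| NablaNegNegL: "GSix (finsert (\<nabla> \<alpha>) \<Gamma> \<Rrightarrow> \<Delta>)
    \<Longrightarrow> GSix (finsert (\<nabla> (\<^bold>\<not> (\<^bold>\<not> \<alpha>))) \<Gamma> \<Rrightarrow> \<Delta>)"
| NablaNegNegR: "GSix (\<Gamma> \<Rrightarrow> finsert (\<nabla> \<alpha>) \<Delta>)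
    \<Longrightarrow> GSix (\<Gamma> \<Rrightarrow> finsert (\<nabla> (\<^bold>\<not> (\<^bold>\<not> \<alpha>))) \<Delta>)"

| NablaR: "GSix (finsert (\<^bold>\<not> \<alpha>) \<Gamma> \<Rrightarrow> finsert \<alpha> \<Delta>) \<Longrightarrow> GSix (\<Gamma> \<Rrightarrow> finsert (\<nabla> \<alpha>) \<Delta>)"
| NablaL: "GSix (finsert (\<nabla> \<alpha>) \<Gamma> \<Rrightarrow> \<Delta>) \<Longrightarrow> GSix (finsert (\<nabla> (\<nabla> \<alpha>)) \<Gamma> \<Rrightarrow> \<Delta>)"
| NegNablaL: "GSix (\<Gamma> \<Rrightarrow> finsert (\<nabla> \<alpha>) \<Delta>) \<Longrightarrow> GSix (finsert (\<^bold>\<not> (\<nabla> \<alpha>)) \<Gamma> \<Rrightarrow> \<Delta>)"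
| NegNablaR: "GSix (finsert (\<nabla> \<alpha>) \<Gamma> \<Rrightarrow> \<Delta>) \<Longrightarrow> GSix (\<Gamma> \<Rrightarrow> finsert (\<^bold>\<not> (\<nabla> \<alpha>)) \<Delta>)"
| NablaNegNablaL: "GSix (\<Gamma> \<Rrightarrow> finsert (\<nabla> \<alpha>) \<Delta>)
    \<Longrightarrow> GSix (finsert (\<nabla> (\<^bold>\<not> (\<nabla> \<alpha>))) \<Gamma> \<Rrightarrow> \<Delta>)"

end

theory Submission
  imports Defs
begin

text \<open>
  Soundness is an induction on derivations. The point is that \<open>designated\<close> is a prime filter
  of the lattice and that \<open>\<nabla>\<close> tests for being different from \<open>Zero\<close>, so that designation of
  \<open>\<alpha>\<close>, \<open>\<^bold>\<not> \<alpha>\<close>, \<open>\<nabla> \<alpha>\<close> and \<open>\<nabla> (\<^bold>\<not> \<alpha>)\<close> for a compound \<open>\<alpha>\<close> is a Boolean combination of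
  designation of the same four kinds of formulas for the immediate subformulas of \<open>\<alpha>\<close>.

  For completeness, an underivable sequent is extended, by Zorn's lemma, to a maximal underivable
  pair of possibly infinite sets \<open>L\<close>, \<open>R\<close>. Maximality alone, without cut, turns every rule
  of the calculus into a closure property of the pair, read from the conclusion to the premises
  (\<open>maximal_saturated\<close>): if the principal formula lies on its side, then the side formulas of some
  premise lie on theirs. A valuation is then read off from the four kinds of literals \<open>p\<close>,
  \<open>\<^bold>\<not> p\<close>, \<open>\<nabla> p\<close>, \<open>\<nabla> (\<^bold>\<not> p)\<close>, and induction on formulas shows that it designates everything
  in \<open>L\<close> and nothing in \<open>R\<close> (\<open>truth_lemma\<close>).
  The rule for \<open>\<nabla>\<close> on the right is not semantically invertible, but this does no harm, since
  \<open>\<nabla> \<alpha>\<close> itself stays in \<open>R\<close>.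

  Since cut preserves validity, its admissibility follows from soundness and completeness.
\<close>

section \<open>Semantics of the connectives\<close>

lemma sup_designated_iff: "sup x y \<in> designated \<longleftrightarrow> x \<in> designated \<or> y \<in> designated"
  by (cases x; cases y) (simp_all add: sup_tv_def less_eq_tv_def designated_def)

lemma inf_designated_iff: "inf x y \<in> designated \<longleftrightarrow> x \<in> designated \<and> y \<in> designated"
  by (cases x; cases y) (simp_all add: inf_tv_def less_eq_tv_def designated_def)

lemma neg_sup: "neg_tv (sup x y) = inf (neg_tv x) (neg_tv y)"
  by (cases x; cases y) (simp_all add: sup_tv_def inf_tv_def less_eq_tv_def)

lemma neg_inf: "neg_tv (inf x y) = sup (neg_tv x) (neg_tv y)"
  by (cases x; cases y) (simp_all add: sup_tv_def inf_tv_def less_eq_tv_def)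

lemma neg_neg: "neg_tv (neg_tv x) = x"
  by (cases x) simp_all

lemma nabla_sup: "nabla_tv (sup x y) = sup (nabla_tv x) (nabla_tv y)"
  by (cases x; cases y) (simp_all add: nabla_tv_def sup_tv_def less_eq_tv_def)

lemma nabla_inf: "nabla_tv (inf x y) = inf (nabla_tv x) (nabla_tv y)"
  by (cases x; cases y) (simp_all add: nabla_tv_def inf_tv_def less_eq_tv_def)

lemma nabla_nabla: "nabla_tv (nabla_tv x) = nabla_tv x"
  by (cases x) (simp_all add: nabla_tv_def)

lemma neg_nabla_designated_iff:
  "neg_tv (nabla_tv x) \<in> designated \<longleftrightarrow> nabla_tv x \<notin> designated"
  by (cases x) (simp_all add: nabla_tv_def designated_def)

lemma nabla_neg_nabla_designated_iff:
  "nabla_tv (neg_tv (nabla_tv x)) \<in> designated \<longleftrightarrow> nabla_tv x \<notin> designated"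
  by (cases x) (simp_all add: nabla_tv_def designated_def)

lemma nabla_designatedI:
  "x \<in> designated \<or> neg_tv x \<notin> designated \<Longrightarrow> nabla_tv x \<in> designated"
  by (cases x) (simp_all add: nabla_tv_def designated_def)

lemmas tv_simps = sup_designated_iff inf_designated_iff neg_sup neg_inf neg_neg nabla_sup
  nabla_inf nabla_nabla neg_nabla_designated_iff nabla_neg_nabla_designated_iff

section \<open>Soundness\<close>

lemma satisfies_finsert_left:
  "satisfies v (finsert \<alpha> \<Gamma> \<Rrightarrow> \<Delta>) \<longleftrightarrow> v \<alpha> \<notin> designated \<or> satisfies v (\<Gamma> \<Rrightarrow> \<Delta>)"
  by auto

lemma satisfies_finsert_right:
  "satisfies v (\<Gamma> \<Rrightarrow> finsert \<alpha> \<Delta>) \<longleftrightarrow> v \<alpha> \<in> designated \<or> satisfies v (\<Gamma> \<Rrightarrow> \<Delta>)"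
  by auto

lemma valuation_simps:
  assumes "valuation v"
  shows "v (\<alpha> \<^bold>\<and> \<beta>) = inf (v \<alpha>) (v \<beta>)" "v (\<alpha> \<^bold>\<or> \<beta>) = sup (v \<alpha>) (v \<beta>)"
    "v (\<^bold>\<not> \<alpha>) = neg_tv (v \<alpha>)" "v (\<nabla> \<alpha>) = nabla_tv (v \<alpha>)"
  using assms by (simp_all add: valuation_def)

lemma GSix_satisfies:
  assumes "GSix S" and "valuation v"
  shows "satisfies v S"
  using assms(1)
proof induction
  case (Ax \<alpha>)
  show ?case by auto
next
  case (NablaR \<alpha> \<Gamma> \<Delta>)
  then show ?case
    using nabla_designatedI[of "v \<alpha>"]
    by (auto simp only: satisfies_finsert_left satisfies_finsert_right
        valuation_simps[OF assms(2)])
qed (simp_all only: satisfies_finsert_left satisfies_finsert_right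
    valuation_simps[OF assms(2)] tv_simps, blast+)

lemma soundness: "GSix S \<Longrightarrow> valid S"
  by (simp add: valid_def GSix_satisfies)

section \<open>Maximal underivable pairs\<close>

lemma weakening:
  assumes "GSix (\<Gamma> \<Rrightarrow> \<Delta>)" and "\<Gamma> |\<subseteq>| \<Gamma>'" and "\<Delta> |\<subseteq>| \<Delta>'"
  shows "GSix (\<Gamma>' \<Rrightarrow> \<Delta>')"
proof -
  have left: "GSix (A |\<union>| \<Gamma> \<Rrightarrow> \<Delta>)" for A
    by (induction A) (simp_all add: assms(1) WeakL)
  have "GSix (A |\<union>| \<Gamma> \<Rrightarrow> B |\<union>| \<Delta>)" for A B
    by (induction B) (simp_all add: left WeakR)
  from this[of \<Gamma>' \<Delta>'] show ?thesis
    using assms(2,3) by (simp add: sup.absorb1)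
qed

text \<open>Derivability of a pair of possibly infinite sets: some sequent with finite parts of these
  sets as its two sides is derivable.\<close>

definition derivable :: "fm set \<Rightarrow> fm set \<Rightarrow> bool" where
  "derivable L R \<longleftrightarrow> (\<exists>\<Gamma> \<Delta>. fset \<Gamma> \<subseteq> L \<and> fset \<Delta> \<subseteq> R \<and> GSix (\<Gamma> \<Rrightarrow> \<Delta>))"

lemma derivable_fset_iff: "derivable (fset \<Gamma>) (fset \<Delta>) \<longleftrightarrow> GSix (\<Gamma> \<Rrightarrow> \<Delta>)"
  unfolding derivable_def using weakening by (metis less_eq_fset.rep_eq order_refl)

definition maximal_underivable :: "fm set \<Rightarrow> fm set \<Rightarrow> bool" where
  "maximal_underivable L R \<longleftrightarrow> \<not> derivable L R \<and>
     (\<forall>L' R'. L \<subseteq> L' \<longrightarrow> R \<subseteq> R' \<longrightarrow> \<not> derivable L' R' \<longrightarrow> L' = L \<and> R' = R)"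

lemma extend_to_maximal_underivable:
  assumes "\<not> derivable L R"
  obtains L' R' where "L \<subseteq> L'" "R \<subseteq> R'" "maximal_underivable L' R'"
proof -
  \<comment> \<open>Pairs of sets of formulas are coded as subsets of the disjoint sum, so that the
    componentwise order becomes inclusion.\<close>
  define \<A> where "\<A> = {X. L <+> R \<subseteq> X \<and> \<not> derivable (Inl -` X) (Inr -` X)}"
  have "L <+> R \<in> \<A>"
  proof -
    have "Inl -` (L <+> R) = L" "Inr -` (L <+> R) = R" by auto
    then show ?thesis using assms by (simp add: \<A>_def)
  qed
  moreover have "\<Union>\<C> \<in> \<A>" if "\<C> \<noteq> {}" and chain: "subset.chain \<A> \<C>" for \<C>
  proof -
    have sub: "\<C> \<subseteq> \<A>" using chain by (simp add: subset_chain_def)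
    have "\<not> derivable (Inl -` \<Union>\<C>) (Inr -` \<Union>\<C>)"
    proof
      assume "derivable (Inl -` \<Union>\<C>) (Inr -` \<Union>\<C>)"
      then obtain \<Gamma> \<Delta> where \<Gamma>: "fset \<Gamma> \<subseteq> Inl -` \<Union>\<C>" and \<Delta>: "fset \<Delta> \<subseteq> Inr -` \<Union>\<C>"
        and der: "GSix (\<Gamma> \<Rrightarrow> \<Delta>)"
        unfolding derivable_def by blast
      have "finite (fset \<Gamma> <+> fset \<Delta>)" by simp
      moreover have "fset \<Gamma> <+> fset \<Delta> \<subseteq> \<Union>\<C>" using \<Gamma> \<Delta> by auto
      ultimately obtain X where X: "X \<in> \<C>" "fset \<Gamma> <+> fset \<Delta> \<subseteq> X"
        using finite_subset_Union_chain[OF _ _ \<open>\<C> \<noteq> {}\<close> chain] by blast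
      then have "derivable (Inl -` X) (Inr -` X)"
        unfolding derivable_def using der by blast
      then show False using X(1) sub by (auto simp: \<A>_def)
    qed
    moreover have "L <+> R \<subseteq> \<Union>\<C>" using \<open>\<C> \<noteq> {}\<close> sub by (fastforce simp: \<A>_def)
    ultimately show ?thesis by (simp add: \<A>_def)
  qed
  ultimately have "\<exists>M\<in>\<A>. \<forall>X\<in>\<A>. M \<subseteq> X \<longrightarrow> X = M"
    by (intro subset_Zorn_nonempty) auto
  then obtain M where M: "M \<in> \<A>" and max: "\<And>X. X \<in> \<A> \<Longrightarrow> M \<subseteq> X \<Longrightarrow> X = M"
    by blast
  have "L' = Inl -` M \<and> R' = Inr -` M"
    if "Inl -` M \<subseteq> L'" "Inr -` M \<subseteq> R'" "\<not> derivable L' R'" for L' R'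
  proof -
    have eqs: "Inl -` (L' <+> R') = L'" "Inr -` (L' <+> R') = R'" by auto
    have "M \<subseteq> L' <+> R'"
    proof
      fix x assume "x \<in> M"
      with that(1,2) show "x \<in> L' <+> R'" by (cases x) auto
    qed
    then have "L' <+> R' = M"
      using M that(3) by (intro max) (auto simp: \<A>_def eqs)
    then show ?thesis using eqs by simp
  qed
  then have maximal: "maximal_underivable (Inl -` M) (Inr -` M)"
    using M by (simp add: maximal_underivable_def \<A>_def)
  show ?thesis
  proof (rule that)
    show "L \<subseteq> Inl -` M" "R \<subseteq> Inr -` M" using M by (auto simp: \<A>_def)
  qed (rule maximal)
qed

lemma maximal_extension_derivable:
  assumes "maximal_underivable L R" and "\<not> (fset A \<subseteq> L \<and> fset B \<subseteq> R)"
  obtains \<Gamma> \<Delta> where "fset \<Gamma> \<subseteq> L" "fset \<Delta> \<subseteq> R" "GSix (A |\<union>| \<Gamma> \<Rrightarrow> B |\<union>| \<Delta>)"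
proof -
  have "derivable (L \<union> fset A) (R \<union> fset B)"
  proof (rule ccontr)
    assume "\<not> derivable (L \<union> fset A) (R \<union> fset B)"
    then have "L \<union> fset A = L \<and> R \<union> fset B = R"
      using assms(1) Un_upper1[of L "fset A"] Un_upper1[of R "fset B"]
      unfolding maximal_underivable_def by blast
    then show False using assms(2) by (simp add: sup.absorb_iff1)
  qed
  then obtain \<Gamma> \<Delta> where sub: "fset \<Gamma> \<subseteq> L \<union> fset A" "fset \<Delta> \<subseteq> R \<union> fset B"
    and der: "GSix (\<Gamma> \<Rrightarrow> \<Delta>)"
    unfolding derivable_def by blast
  have "GSix (A |\<union>| (\<Gamma> |-| A) \<Rrightarrow> B |\<union>| (\<Delta> |-| B))"
    using der by (rule weakening) auto
  moreover have "fset (\<Gamma> |-| A) \<subseteq> L" "fset (\<Delta> |-| B) \<subseteq> R" using sub by auto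
  ultimately show ?thesis using that by blast
qed

text \<open>A derivation rule whose premises have side formulas \<open>A \<Rrightarrow> B\<close> and \<open>A' \<Rrightarrow> B'\<close> and whose
  conclusion has principal formulas \<open>C \<Rrightarrow> D\<close> is a closure property of maximal underivable pairs.
  Both premises may be brought to a common context by weakening. A rule with one premise is
  the case in which the two premises coincide.\<close>

lemma maximal_saturated:
  assumes max: "maximal_underivable L R"
    and rule: "\<And>\<Gamma> \<Delta>. GSix (A |\<union>| \<Gamma> \<Rrightarrow> B |\<union>| \<Delta>) \<Longrightarrow> GSix (A' |\<union>| \<Gamma> \<Rrightarrow> B' |\<union>| \<Delta>)
      \<Longrightarrow> GSix (C |\<union>| \<Gamma> \<Rrightarrow> D |\<union>| \<Delta>)"
    and principal: "fset C \<subseteq> L" "fset D \<subseteq> R"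
  shows "(fset A \<subseteq> L \<and> fset B \<subseteq> R) \<or> (fset A' \<subseteq> L \<and> fset B' \<subseteq> R)"
proof (rule ccontr)
  assume neg: "\<not> ?thesis"
  then have "\<not> (fset A \<subseteq> L \<and> fset B \<subseteq> R)" by blast
  then obtain \<Gamma> \<Delta> where 1: "fset \<Gamma> \<subseteq> L" "fset \<Delta> \<subseteq> R" "GSix (A |\<union>| \<Gamma> \<Rrightarrow> B |\<union>| \<Delta>)"
    by (rule maximal_extension_derivable[OF max])
  from neg have "\<not> (fset A' \<subseteq> L \<and> fset B' \<subseteq> R)" by blast
  then obtain \<Gamma>' \<Delta>' where 2: "fset \<Gamma>' \<subseteq> L" "fset \<Delta>' \<subseteq> R" "GSix (A' |\<union>| \<Gamma>' \<Rrightarrow> B' |\<union>| \<Delta>')"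
    by (rule maximal_extension_derivable[OF max])
  have "GSix (C |\<union>| (\<Gamma> |\<union>| \<Gamma>') \<Rrightarrow> D |\<union>| (\<Delta> |\<union>| \<Delta>'))"
  proof (rule rule)
    show "GSix (A |\<union>| (\<Gamma> |\<union>| \<Gamma>') \<Rrightarrow> B |\<union>| (\<Delta> |\<union>| \<Delta>'))"
      by (rule weakening[OF 1(3)]) auto
    show "GSix (A' |\<union>| (\<Gamma> |\<union>| \<Gamma>') \<Rrightarrow> B' |\<union>| (\<Delta> |\<union>| \<Delta>'))"
      by (rule weakening[OF 2(3)]) auto
  qed
  moreover have "fset (C |\<union>| (\<Gamma> |\<union>| \<Gamma>')) \<subseteq> L" "fset (D |\<union>| (\<Delta> |\<union>| \<Delta>')) \<subseteq> R"
    using 1 2 principal by auto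
  ultimately have "derivable L R" unfolding derivable_def by blast
  then show False using max by (simp add: maximal_underivable_def)
qed

lemma maximal_disjoint:
  assumes "maximal_underivable L R"
  shows "\<alpha> \<notin> L \<or> \<alpha> \<notin> R"
  using assms Ax[of \<alpha>] unfolding maximal_underivable_def derivable_def
  by (metis bot_fset.rep_eq empty_subsetI finsert.rep_eq insert_subset)

lemma maximal_left:
  assumes "maximal_underivable L R"
  shows "\<alpha> \<^bold>\<or> \<beta> \<in> L \<Longrightarrow> \<alpha> \<in> L \<or> \<beta> \<in> L"
    and "\<^bold>\<not> (\<alpha> \<^bold>\<or> \<beta>) \<in> L \<Longrightarrow> \<^bold>\<not> \<alpha> \<in> L \<and> \<^bold>\<not> \<beta> \<in> L"
    and "\<nabla> (\<alpha> \<^bold>\<or> \<beta>) \<in> L \<Longrightarrow> \<nabla> \<alpha> \<in> L \<or> \<nabla> \<beta> \<in> L"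
    and "\<nabla> (\<^bold>\<not> (\<alpha> \<^bold>\<or> \<beta>)) \<in> L \<Longrightarrow> \<nabla> (\<^bold>\<not> \<alpha>) \<in> L \<and> \<nabla> (\<^bold>\<not> \<beta>) \<in> L"
    and "\<alpha> \<^bold>\<and> \<beta> \<in> L \<Longrightarrow> \<alpha> \<in> L \<and> \<beta> \<in> L"
    and "\<^bold>\<not> (\<alpha> \<^bold>\<and> \<beta>) \<in> L \<Longrightarrow> \<^bold>\<not> \<alpha> \<in> L \<or> \<^bold>\<not> \<beta> \<in> L"
    and "\<nabla> (\<alpha> \<^bold>\<and> \<beta>) \<in> L \<Longrightarrow> \<nabla> \<alpha> \<in> L \<and> \<nabla> \<beta> \<in> L"
    and "\<nabla> (\<^bold>\<not> (\<alpha> \<^bold>\<and> \<beta>)) \<in> L \<Longrightarrow> \<nabla> (\<^bold>\<not> \<alpha>) \<in> L \<or> \<nabla> (\<^bold>\<not> \<beta>) \<in> L"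
    and "\<^bold>\<not> (\<^bold>\<not> \<alpha>) \<in> L \<Longrightarrow> \<alpha> \<in> L"
    and "\<nabla> (\<^bold>\<not> (\<^bold>\<not> \<alpha>)) \<in> L \<Longrightarrow> \<nabla> \<alpha> \<in> L"
    and "\<nabla> (\<nabla> \<alpha>) \<in> L \<Longrightarrow> \<nabla> \<alpha> \<in> L"
    and "\<^bold>\<not> (\<nabla> \<alpha>) \<in> L \<Longrightarrow> \<nabla> \<alpha> \<in> R"
    and "\<nabla> (\<^bold>\<not> (\<nabla> \<alpha>)) \<in> L \<Longrightarrow> \<nabla> \<alpha> \<in> R"
proof -
  have branch: "\<phi> \<in> L \<or> \<psi> \<in> L" if "\<chi> \<in> L"
    and "\<And>\<Gamma> \<Delta>. GSix (finsert \<phi> \<Gamma> \<Rrightarrow> \<Delta>) \<Longrightarrow> GSix (finsert \<psi> \<Gamma> \<Rrightarrow> \<Delta>)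
      \<Longrightarrow> GSix (finsert \<chi> \<Gamma> \<Rrightarrow> \<Delta>)" for \<phi> \<psi> \<chi>
    using maximal_saturated[OF assms, of "{|\<phi>|}" "{||}" "{|\<psi>|}" "{||}" "{|\<chi>|}" "{||}"] that
    by simp
  have pair: "\<phi> \<in> L \<and> \<psi> \<in> L" if "\<chi> \<in> L"
    and "\<And>\<Gamma> \<Delta>. GSix (finsert \<phi> (finsert \<psi> \<Gamma>) \<Rrightarrow> \<Delta>) \<Longrightarrow> GSix (finsert \<chi> \<Gamma> \<Rrightarrow> \<Delta>)" for \<phi> \<psi> \<chi>
    using maximal_saturated[OF assms, of "{|\<phi>, \<psi>|}" "{||}" "{|\<phi>, \<psi>|}" "{||}" "{|\<chi>|}" "{||}"]
      that by simp
  have switch: "\<phi> \<in> R" if "\<chi> \<in> L"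
    and "\<And>\<Gamma> \<Delta>. GSix (\<Gamma> \<Rrightarrow> finsert \<phi> \<Delta>) \<Longrightarrow> GSix (finsert \<chi> \<Gamma> \<Rrightarrow> \<Delta>)" for \<phi> \<chi>
    using maximal_saturated[OF assms, of "{||}" "{|\<phi>|}" "{||}" "{|\<phi>|}" "{|\<chi>|}" "{||}"] that
    by simp
  show "\<alpha> \<^bold>\<or> \<beta> \<in> L \<Longrightarrow> \<alpha> \<in> L \<or> \<beta> \<in> L"
    by (erule branch) (rule DisjL)
  show "\<^bold>\<not> (\<alpha> \<^bold>\<or> \<beta>) \<in> L \<Longrightarrow> \<^bold>\<not> \<alpha> \<in> L \<and> \<^bold>\<not> \<beta> \<in> L"
    by (erule pair) (rule NegDisjL)
  show "\<nabla> (\<alpha> \<^bold>\<or> \<beta>) \<in> L \<Longrightarrow> \<nabla> \<alpha> \<in> L \<or> \<nabla> \<beta> \<in> L"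
    by (erule branch) (rule NablaDisjL)
  show "\<nabla> (\<^bold>\<not> (\<alpha> \<^bold>\<or> \<beta>)) \<in> L \<Longrightarrow> \<nabla> (\<^bold>\<not> \<alpha>) \<in> L \<and> \<nabla> (\<^bold>\<not> \<beta>) \<in> L"
    by (erule pair) (rule NablaNegDisjL)
  show "\<alpha> \<^bold>\<and> \<beta> \<in> L \<Longrightarrow> \<alpha> \<in> L \<and> \<beta> \<in> L"
    by (erule pair) (rule ConjL)
  show "\<^bold>\<not> (\<alpha> \<^bold>\<and> \<beta>) \<in> L \<Longrightarrow> \<^bold>\<not> \<alpha> \<in> L \<or> \<^bold>\<not> \<beta> \<in> L"
    by (erule branch) (rule NegConjL)
  show "\<nabla> (\<alpha> \<^bold>\<and> \<beta>) \<in> L \<Longrightarrow> \<nabla> \<alpha> \<in> L \<and> \<nabla> \<beta> \<in> L"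
    by (erule pair) (rule NablaConjL)
  show "\<nabla> (\<^bold>\<not> (\<alpha> \<^bold>\<and> \<beta>)) \<in> L \<Longrightarrow> \<nabla> (\<^bold>\<not> \<alpha>) \<in> L \<or> \<nabla> (\<^bold>\<not> \<beta>) \<in> L"
    by (erule branch) (rule NablaNegConjL)
  show "\<^bold>\<not> (\<^bold>\<not> \<alpha>) \<in> L \<Longrightarrow> \<alpha> \<in> L"
    using branch[of "\<^bold>\<not> (\<^bold>\<not> \<alpha>)" \<alpha> \<alpha>] NegNegL by blast
  show "\<nabla> (\<^bold>\<not> (\<^bold>\<not> \<alpha>)) \<in> L \<Longrightarrow> \<nabla> \<alpha> \<in> L"
    using branch[of "\<nabla> (\<^bold>\<not> (\<^bold>\<not> \<alpha>))" "\<nabla> \<alpha>" "\<nabla> \<alpha>"] NablaNegNegL by blast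
  show "\<nabla> (\<nabla> \<alpha>) \<in> L \<Longrightarrow> \<nabla> \<alpha> \<in> L"
    using branch[of "\<nabla> (\<nabla> \<alpha>)" "\<nabla> \<alpha>" "\<nabla> \<alpha>"] NablaL by blast
  show "\<^bold>\<not> (\<nabla> \<alpha>) \<in> L \<Longrightarrow> \<nabla> \<alpha> \<in> R"
    by (erule switch) (rule NegNablaL)
  show "\<nabla> (\<^bold>\<not> (\<nabla> \<alpha>)) \<in> L \<Longrightarrow> \<nabla> \<alpha> \<in> R"
    by (erule switch) (rule NablaNegNablaL)
qed

lemma maximal_right:
  assumes "maximal_underivable L R"
  shows "\<alpha> \<^bold>\<or> \<beta> \<in> R \<Longrightarrow> \<alpha> \<in> R \<and> \<beta> \<in> R"
    and "\<^bold>\<not> (\<alpha> \<^bold>\<or> \<beta>) \<in> R \<Longrightarrow> \<^bold>\<not> \<alpha> \<in> R \<or> \<^bold>\<not> \<beta> \<in> R"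
    and "\<nabla> (\<alpha> \<^bold>\<or> \<beta>) \<in> R \<Longrightarrow> \<nabla> \<alpha> \<in> R \<and> \<nabla> \<beta> \<in> R"
    and "\<nabla> (\<^bold>\<not> (\<alpha> \<^bold>\<or> \<beta>)) \<in> R \<Longrightarrow> \<nabla> (\<^bold>\<not> \<alpha>) \<in> R \<or> \<nabla> (\<^bold>\<not> \<beta>) \<in> R"
    and "\<alpha> \<^bold>\<and> \<beta> \<in> R \<Longrightarrow> \<alpha> \<in> R \<or> \<beta> \<in> R"
    and "\<^bold>\<not> (\<alpha> \<^bold>\<and> \<beta>) \<in> R \<Longrightarrow> \<^bold>\<not> \<alpha> \<in> R \<and> \<^bold>\<not> \<beta> \<in> R"
    and "\<nabla> (\<alpha> \<^bold>\<and> \<beta>) \<in> R \<Longrightarrow> \<nabla> \<alpha> \<in> R \<or> \<nabla> \<beta> \<in> R"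
    and "\<nabla> (\<^bold>\<not> (\<alpha> \<^bold>\<and> \<beta>)) \<in> R \<Longrightarrow> \<nabla> (\<^bold>\<not> \<alpha>) \<in> R \<and> \<nabla> (\<^bold>\<not> \<beta>) \<in> R"
    and "\<^bold>\<not> (\<^bold>\<not> \<alpha>) \<in> R \<Longrightarrow> \<alpha> \<in> R"
    and "\<nabla> (\<^bold>\<not> (\<^bold>\<not> \<alpha>)) \<in> R \<Longrightarrow> \<nabla> \<alpha> \<in> R"
    and "\<^bold>\<not> (\<nabla> \<alpha>) \<in> R \<Longrightarrow> \<nabla> \<alpha> \<in> L"
    and "\<nabla> \<alpha> \<in> R \<Longrightarrow> \<^bold>\<not> \<alpha> \<in> L \<and> \<alpha> \<in> R"
proof -
  have branch: "\<phi> \<in> R \<or> \<psi> \<in> R" if "\<chi> \<in> R"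
    and "\<And>\<Gamma> \<Delta>. GSix (\<Gamma> \<Rrightarrow> finsert \<phi> \<Delta>) \<Longrightarrow> GSix (\<Gamma> \<Rrightarrow> finsert \<psi> \<Delta>)
      \<Longrightarrow> GSix (\<Gamma> \<Rrightarrow> finsert \<chi> \<Delta>)" for \<phi> \<psi> \<chi>
    using maximal_saturated[OF assms, of "{||}" "{|\<phi>|}" "{||}" "{|\<psi>|}" "{||}" "{|\<chi>|}"] that
    by simp
  have pair: "\<phi> \<in> R \<and> \<psi> \<in> R" if "\<chi> \<in> R"
    and "\<And>\<Gamma> \<Delta>. GSix (\<Gamma> \<Rrightarrow> finsert \<phi> (finsert \<psi> \<Delta>)) \<Longrightarrow> GSix (\<Gamma> \<Rrightarrow> finsert \<chi> \<Delta>)" for \<phi> \<psi> \<chi>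
    using maximal_saturated[OF assms, of "{||}" "{|\<phi>, \<psi>|}" "{||}" "{|\<phi>, \<psi>|}" "{||}" "{|\<chi>|}"]
      that by simp
  show "\<alpha> \<^bold>\<or> \<beta> \<in> R \<Longrightarrow> \<alpha> \<in> R \<and> \<beta> \<in> R"
    by (erule pair) (rule DisjR)
  show "\<^bold>\<not> (\<alpha> \<^bold>\<or> \<beta>) \<in> R \<Longrightarrow> \<^bold>\<not> \<alpha> \<in> R \<or> \<^bold>\<not> \<beta> \<in> R"
    by (erule branch) (rule NegDisjR)
  show "\<nabla> (\<alpha> \<^bold>\<or> \<beta>) \<in> R \<Longrightarrow> \<nabla> \<alpha> \<in> R \<and> \<nabla> \<beta> \<in> R"
    by (erule pair) (rule NablaDisjR)
  show "\<nabla> (\<^bold>\<not> (\<alpha> \<^bold>\<or> \<beta>)) \<in> R \<Longrightarrow> \<nabla> (\<^bold>\<not> \<alpha>) \<in> R \<or> \<nabla> (\<^bold>\<not> \<beta>) \<in> R"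
    by (erule branch) (rule NablaNegDisjR)
  show "\<alpha> \<^bold>\<and> \<beta> \<in> R \<Longrightarrow> \<alpha> \<in> R \<or> \<beta> \<in> R"
    by (erule branch) (rule ConjR)
  show "\<^bold>\<not> (\<alpha> \<^bold>\<and> \<beta>) \<in> R \<Longrightarrow> \<^bold>\<not> \<alpha> \<in> R \<and> \<^bold>\<not> \<beta> \<in> R"
    by (erule pair) (rule NegConjR)
  show "\<nabla> (\<alpha> \<^bold>\<and> \<beta>) \<in> R \<Longrightarrow> \<nabla> \<alpha> \<in> R \<or> \<nabla> \<beta> \<in> R"
    by (erule branch) (rule NablaConjR)
  show "\<nabla> (\<^bold>\<not> (\<alpha> \<^bold>\<and> \<beta>)) \<in> R \<Longrightarrow> \<nabla> (\<^bold>\<not> \<alpha>) \<in> R \<and> \<nabla> (\<^bold>\<not> \<beta>) \<in> R"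
    by (erule pair) (rule NablaNegConjR)
  show "\<^bold>\<not> (\<^bold>\<not> \<alpha>) \<in> R \<Longrightarrow> \<alpha> \<in> R"
    using branch[of "\<^bold>\<not> (\<^bold>\<not> \<alpha>)" \<alpha> \<alpha>] NegNegR by blast
  show "\<nabla> (\<^bold>\<not> (\<^bold>\<not> \<alpha>)) \<in> R \<Longrightarrow> \<nabla> \<alpha> \<in> R"
    using branch[of "\<nabla> (\<^bold>\<not> (\<^bold>\<not> \<alpha>))" "\<nabla> \<alpha>" "\<nabla> \<alpha>"] NablaNegNegR by blast
  show "\<nabla> \<alpha> \<in> L" if "\<^bold>\<not> (\<nabla> \<alpha>) \<in> R"
    using maximal_saturated[OF assms, of "{|\<nabla> \<alpha>|}" "{||}" "{|\<nabla> \<alpha>|}" "{||}" "{||}"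
        "{|\<^bold>\<not> (\<nabla> \<alpha>)|}"] that NegNablaR by simp
  show "\<^bold>\<not> \<alpha> \<in> L \<and> \<alpha> \<in> R" if "\<nabla> \<alpha> \<in> R"
    using maximal_saturated[OF assms, of "{|\<^bold>\<not> \<alpha>|}" "{|\<alpha>|}" "{|\<^bold>\<not> \<alpha>|}" "{|\<alpha>|}" "{||}"
        "{|\<nabla> \<alpha>|}"] that NablaR by simp
qed

section \<open>The valuation of a maximal pair\<close>

primrec eval :: "(nat \<Rightarrow> tv) \<Rightarrow> fm \<Rightarrow> tv" where
  "eval e (Var p) = e p"
| "eval e (\<alpha> \<^bold>\<and> \<beta>) = inf (eval e \<alpha>) (eval e \<beta>)"
| "eval e (\<alpha> \<^bold>\<or> \<beta>) = sup (eval e \<alpha>) (eval e \<beta>)"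
| "eval e (\<^bold>\<not> \<alpha>) = neg_tv (eval e \<alpha>)"
| "eval e (\<nabla> \<alpha>) = nabla_tv (eval e \<alpha>)"

lemma valuation_eval: "valuation (eval e)"
  by (simp add: valuation_def)

text \<open>\<open>Zero\<close> and \<open>One\<close> are the only values for which \<open>\<nabla> p\<close>, respectively
  \<open>\<nabla> (\<^bold>\<not> p)\<close>, is not designated, so they are used exactly when \<open>R\<close> demands it. The other four
  values realise all combinations of designation of \<open>p\<close> and of \<open>\<^bold>\<not> p\<close>; of these, the one chosen
  designates only what \<open>L\<close> demands.\<close>

definition canonical_assignment :: "fm set \<Rightarrow> fm set \<Rightarrow> nat \<Rightarrow> tv" where
  "canonical_assignment L R p =
    (if \<nabla> (Var p) \<in> R then Zero
     else if \<nabla> (\<^bold>\<not> (Var p)) \<in> R then One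
     else if Var p \<in> L then (if \<^bold>\<not> (Var p) \<in> L then Bb else TwoThirds)
     else (if \<^bold>\<not> (Var p) \<in> L then Third else Nn))"

text \<open>A valuation agrees with the pair on a formula if it does not contradict the side of the pair on which the
  formula occurs, if any.\<close>

definition agrees :: "(fm \<Rightarrow> tv) \<Rightarrow> fm set \<Rightarrow> fm set \<Rightarrow> fm \<Rightarrow> bool" where
  "agrees v L R \<alpha> \<longleftrightarrow> (\<alpha> \<in> L \<longrightarrow> v \<alpha> \<in> designated) \<and> (\<alpha> \<in> R \<longrightarrow> v \<alpha> \<notin> designated)"

text \<open>The statement is proved simultaneously for a formula and its variants under \<open>\<^bold>\<not>\<close>, \<open>\<nabla>\<close> and
  \<open>\<nabla>\<close> after \<open>\<^bold>\<not>\<close>, because the rules decompose formulas only under these prefixes.\<close>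

lemma truth_lemma:
  assumes max: "maximal_underivable L R"
  defines "v \<equiv> eval (canonical_assignment L R)"
  shows "agrees v L R \<alpha> \<and> agrees v L R (\<^bold>\<not> \<alpha>) \<and> agrees v L R (\<nabla> \<alpha>) \<and>
    agrees v L R (\<nabla> (\<^bold>\<not> \<alpha>))"
proof (induction \<alpha>)
  case (Var p)
  let ?p = "Var p"
  have zero: "\<^bold>\<not> ?p \<in> L \<and> ?p \<in> R" if "\<nabla> ?p \<in> R"
    using maximal_right(12)[OF max that] .
  have one: "?p \<in> L \<and> \<^bold>\<not> ?p \<in> R" if "\<nabla> (\<^bold>\<not> ?p) \<in> R"
    using maximal_right(12)[OF max that] maximal_left(9)[OF max] by blast
  show ?case
    using zero one maximal_disjoint[OF max, of ?p] maximal_disjoint[OF max, of "\<^bold>\<not> ?p"]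
      maximal_disjoint[OF max, of "\<nabla> ?p"] maximal_disjoint[OF max, of "\<nabla> (\<^bold>\<not> ?p)"]
    by (auto simp: agrees_def v_def canonical_assignment_def designated_def nabla_tv_def)
next
  case (Conj \<alpha> \<beta>)
  then have ih: "agrees v L R \<alpha> \<and> agrees v L R \<beta>"
    "agrees v L R (\<^bold>\<not> \<alpha>) \<and> agrees v L R (\<^bold>\<not> \<beta>)"
    "agrees v L R (\<nabla> \<alpha>) \<and> agrees v L R (\<nabla> \<beta>)"
    "agrees v L R (\<nabla> (\<^bold>\<not> \<alpha>)) \<and> agrees v L R (\<nabla> (\<^bold>\<not> \<beta>))"
    by simp_all
  have "agrees v L R (\<alpha> \<^bold>\<and> \<beta>)"
    using ih(1) maximal_left(5)[OF max, of \<alpha> \<beta>] maximal_right(5)[OF max, of \<alpha> \<beta>]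
    by (auto simp: agrees_def v_def tv_simps)
  moreover have "agrees v L R (\<^bold>\<not> (\<alpha> \<^bold>\<and> \<beta>))"
    using ih(2) maximal_left(6)[OF max, of \<alpha> \<beta>] maximal_right(6)[OF max, of \<alpha> \<beta>]
    by (auto simp: agrees_def v_def tv_simps)
  moreover have "agrees v L R (\<nabla> (\<alpha> \<^bold>\<and> \<beta>))"
    using ih(3) maximal_left(7)[OF max, of \<alpha> \<beta>] maximal_right(7)[OF max, of \<alpha> \<beta>]
    by (auto simp: agrees_def v_def tv_simps)
  moreover have "agrees v L R (\<nabla> (\<^bold>\<not> (\<alpha> \<^bold>\<and> \<beta>)))"
    using ih(4) maximal_left(8)[OF max, of \<alpha> \<beta>] maximal_right(8)[OF max, of \<alpha> \<beta>]
    by (auto simp: agrees_def v_def tv_simps)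
  ultimately show ?case by blast
next
  case (Disj \<alpha> \<beta>)
  then have ih: "agrees v L R \<alpha> \<and> agrees v L R \<beta>"
    "agrees v L R (\<^bold>\<not> \<alpha>) \<and> agrees v L R (\<^bold>\<not> \<beta>)"
    "agrees v L R (\<nabla> \<alpha>) \<and> agrees v L R (\<nabla> \<beta>)"
    "agrees v L R (\<nabla> (\<^bold>\<not> \<alpha>)) \<and> agrees v L R (\<nabla> (\<^bold>\<not> \<beta>))"
    by simp_all
  have "agrees v L R (\<alpha> \<^bold>\<or> \<beta>)"
    using ih(1) maximal_left(1)[OF max, of \<alpha> \<beta>] maximal_right(1)[OF max, of \<alpha> \<beta>]
    by (auto simp: agrees_def v_def tv_simps)
  moreover have "agrees v L R (\<^bold>\<not> (\<alpha> \<^bold>\<or> \<beta>))"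
    using ih(2) maximal_left(2)[OF max, of \<alpha> \<beta>] maximal_right(2)[OF max, of \<alpha> \<beta>]
    by (auto simp: agrees_def v_def tv_simps)
  moreover have "agrees v L R (\<nabla> (\<alpha> \<^bold>\<or> \<beta>))"
    using ih(3) maximal_left(3)[OF max, of \<alpha> \<beta>] maximal_right(3)[OF max, of \<alpha> \<beta>]
    by (auto simp: agrees_def v_def tv_simps)
  moreover have "agrees v L R (\<nabla> (\<^bold>\<not> (\<alpha> \<^bold>\<or> \<beta>)))"
    using ih(4) maximal_left(4)[OF max, of \<alpha> \<beta>] maximal_right(4)[OF max, of \<alpha> \<beta>]
    by (auto simp: agrees_def v_def tv_simps)
  ultimately show ?case by blast
next
  case (Neg \<alpha>)
  then show ?case
    using maximal_left(9,10)[OF max, of \<alpha>] maximal_right(9,10)[OF max, of \<alpha>]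
    by (simp add: agrees_def v_def tv_simps)
next
  case (Nabla \<alpha>)
  \<comment> \<open>The calculus has no rules introducing \<open>\<nabla> (\<nabla> \<alpha>)\<close> or \<open>\<nabla> (\<^bold>\<not> (\<nabla> \<alpha>))\<close> specifically on the
    right; both cases reduce to the rule for \<open>\<nabla>\<close> on the right.\<close>
  have "\<nabla> \<alpha> \<in> R" if "\<nabla> (\<nabla> \<alpha>) \<in> R"
    using maximal_right(12)[OF max that] by blast
  moreover have "\<nabla> \<alpha> \<in> L" if "\<nabla> (\<^bold>\<not> (\<nabla> \<alpha>)) \<in> R"
    using maximal_right(12)[OF max that] maximal_left(9)[OF max] by blast
  ultimately show ?case
    using Nabla maximal_left(11-13)[OF max, of \<alpha>] maximal_right(11)[OF max, of \<alpha>]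
    by (simp add: agrees_def v_def tv_simps)
qed

section \<open>Completeness and admissibility of cut\<close>

lemma completeness:
  assumes "valid (\<Gamma> \<Rrightarrow> \<Delta>)"
  shows "GSix (\<Gamma> \<Rrightarrow> \<Delta>)"
proof (rule ccontr)
  assume "\<not> GSix (\<Gamma> \<Rrightarrow> \<Delta>)"
  then have "\<not> derivable (fset \<Gamma>) (fset \<Delta>)" by (simp add: derivable_fset_iff)
  then obtain L R where sub: "fset \<Gamma> \<subseteq> L" "fset \<Delta> \<subseteq> R" and max: "maximal_underivable L R"
    by (rule extend_to_maximal_underivable)
  let ?v = "eval (canonical_assignment L R)"
  have "satisfies ?v (\<Gamma> \<Rrightarrow> \<Delta>)"
    using assms valuation_eval by (simp only: valid_def)
  moreover have "agrees ?v L R \<alpha>" for \<alpha>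
    using truth_lemma[OF max] by blast
  ultimately show False
    using sub by (auto simp: agrees_def)
qed

theorem theorem5p1:
  "(\<forall>\<Gamma> \<Delta>. GSix (\<Gamma> \<Rrightarrow> \<Delta>) \<longleftrightarrow> valid (\<Gamma> \<Rrightarrow> \<Delta>)) \<and>
   (\<forall>\<Gamma> \<Delta> \<alpha>. GSix (\<Gamma> \<Rrightarrow> finsert \<alpha> \<Delta>) \<longrightarrow> GSix (finsert \<alpha> \<Gamma> \<Rrightarrow> \<Delta>) \<longrightarrow> GSix (\<Gamma> \<Rrightarrow> \<Delta>))"
proof -
  have iff: "GSix (\<Gamma> \<Rrightarrow> \<Delta>) \<longleftrightarrow> valid (\<Gamma> \<Rrightarrow> \<Delta>)" for \<Gamma> \<Delta>
    using soundness completeness by blast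
  moreover have "valid (\<Gamma> \<Rrightarrow> \<Delta>)"
    if "valid (\<Gamma> \<Rrightarrow> finsert \<alpha> \<Delta>)" "valid (finsert \<alpha> \<Gamma> \<Rrightarrow> \<Delta>)" for \<Gamma> \<Delta> \<alpha>
    using that unfolding valid_def satisfies_finsert_left satisfies_finsert_right by blast
  ultimately show ?thesis by blast
qed

end
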